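(* Let $m$ be a positive integer. For all integers $n,k\ge0$ we have \[ \mathrm{ac}^k(n,m)=\sum_{3i+j+r(m-1)+2s+cm+dm=n-2k}(-1)^r2^i\binom{i+k}{k}\binom{i+j}{j}\binom{i}{r}\binom{i+k+s-1}{s}\binom{k}{c}\binom{i+k+d-1}{d}. \]
   Context: A composition of $n$ is a finite sequence $\alpha=(\alpha_1,\ldots,\alpha_\ell)$ of positive integers with $\alpha_1+\cdots+\alpha_\ell=n$; the empty sequence ($\ell=0$) is the only composition of $0$. $\mathrm{ac}^k(n,m)$ is the number of compositions $\alpha=(\alpha_1,\ldots,\alpha_\ell)$ of $n$ such that $\#\{1\le i\le \ell/2:\alpha_i\equiv\alpha_{\ell+1-i}\pmod m\}=k$. Convention for binomial coefficients, for integers $a,b$: $\binom{a}{b}=\frac{a!}{b!(a-b)!}$ if $a\ge b\ge1$; $\binom{a}{b}=1$ if $b=0$ (for every integer $a$, including $a=-1$); $\binom{a}{b}=0$ otherwise. All summation indices range over nonnegative integers; only finitely many terms are nonzero. *)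

theory Defs
  imports "HOL-Number_Theory.Cong" "HOL-Library.Groups_Big_Fun"
begin

definition compositions :: "nat \<Rightarrow> nat list set" where
  "compositions n = {\<alpha>. (\<forall>a \<in> set \<alpha>. 0 < a) \<and> sum_list \<alpha> = n}"

text \<open>Lists are indexed from 0: the i-th part (counted from 1) of \<open>\<alpha>\<close> is \<open>\<alpha> ! (i - 1)\<close>, and the
  \<open>(\<ell> + 1 - i)\<close>-th part is \<open>\<alpha> ! (\<ell> - i)\<close>, where \<open>\<ell> = length \<alpha>\<close>.\<close>

definition ac :: "nat \<Rightarrow> nat \<Rightarrow> nat \<Rightarrow> nat" where
  "ac k n m = card {\<alpha> \<in> compositions n.
     card {i \<in> {1..length \<alpha> div 2}. [\<alpha> ! (i - 1) = \<alpha> ! (length \<alpha> - i)] (mod m)} = k}"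

text \<open>The upper argument may be negative: \<open>binom (-1) 0 = 1\<close>. This is not the generalized binomial
  coefficient \<open>gchoose\<close>, because \<open>binom a b = 0\<close> for \<open>a < 0 < b\<close>.\<close>

definition binom :: "int \<Rightarrow> int \<Rightarrow> int" where
  "binom a b =
     (if b = 0 then 1
      else if a \<ge> b \<and> b \<ge> 1 then int (nat a choose nat b)
      else 0)"

definition ac_term :: "nat \<Rightarrow> nat \<times> nat \<times> nat \<times> nat \<times> nat \<times> nat \<Rightarrow> int" where
  "ac_term k = (\<lambda>(i, j, r, s, c, d).
     (- 1) ^ r * 2 ^ i * binom (int i + int k) (int k) * binom (int i + int j) (int j)
       * binom (int i) (int r) * binom (int i + int k + int s - 1) (int s)
       * binom (int k) (int c) * binom (int i + int k + int d - 1) (int d))"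

definition ac_index :: "nat \<Rightarrow> nat \<Rightarrow> nat \<Rightarrow> (nat \<times> nat \<times> nat \<times> nat \<times> nat \<times> nat) set" where
  "ac_index m n k = {(i, j, r, s, c, d).
     3 * int i + int j + int r * (int m - 1) + 2 * int s + int c * int m + int d * int m
       = int n - 2 * int k}"

lemma finite_compositions: "finite (compositions n)"
proof -
  have "length \<alpha> \<le> sum_list \<alpha>" if "\<forall>a \<in> set \<alpha>. 0 < a" for \<alpha> :: "nat list"
    using that by (induction \<alpha>) auto
  then have "compositions n \<subseteq> {\<alpha>. set \<alpha> \<subseteq> {..n} \<and> length \<alpha> \<le> n}"
    by (auto simp: compositions_def intro: member_le_sum_list)
  then show ?thesis
    using finite_lists_length_le[of "{..n}" n] finite_subset by blast
qed

text \<open>For \<open>m = 1\<close> the index set is infinite (\<open>r\<close> is unconstrained), so the sum over it has to be taken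
  over the nonzero terms, as \<^term>\<open>Sum_any\<close> does; there are only finitely many of these, so that
  the convention giving a sum with infinite support the value 0 is not used.\<close>

lemma finite_support_ac_term:
  assumes "m > 0"
  shows "finite {x. (if x \<in> ac_index m n k then ac_term k x else 0) \<noteq> 0}"
proof -
  have "{x. (if x \<in> ac_index m n k then ac_term k x else 0) \<noteq> 0}
      \<subseteq> {..n} \<times> {..n} \<times> {..n} \<times> {..n} \<times> {..n} \<times> {..n}"
  proof
    fix x assume "x \<in> {x. (if x \<in> ac_index m n k then ac_term k x else 0) \<noteq> 0}"
    then obtain i j r s c d where x: "x = (i, j, r, s, c, d)"
      and idx: "3 * int i + int j + int r * (int m - 1) + 2 * int s + int c * int m + int d * int m
        = int n - 2 * int k"
      and nz: "ac_term k (i, j, r, s, c, d) \<noteq> 0"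
      by (cases x) (auto simp: ac_index_def split: if_splits)
    have "binom (int i) (int r) \<noteq> 0" using nz by (auto simp: ac_term_def)
    then have "r \<le> i" by (auto simp: binom_def split: if_splits)
    moreover have "int r * (int m - 1) \<ge> 0" using assms by simp
    moreover have "int c * int m \<ge> int c * 1" using assms by (intro mult_left_mono) simp_all
    moreover have "int d * int m \<ge> int d * 1" using assms by (intro mult_left_mono) simp_all
    ultimately show "x \<in> {..n} \<times> {..n} \<times> {..n} \<times> {..n} \<times> {..n} \<times> {..n}"
      using idx by (auto simp: x)
  qed
  then show ?thesis by (rule finite_subset) simp
qed

end

theory Submission
  imports Defs "HOL-Computational_Algebra.Formal_Power_Series"
begin

text \<open>
  A composition is built from its middle (nothing, or a single part) by wrapping pairs of parts
  around it, one part on each side. The middle has generating function \<open>1 / (1 - x)\<close>. Write \<open>A\<close> and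
  \<open>B\<close> for the generating functions, by sum, of the pairs of positive integers that are congruent and
  incongruent modulo \<open>m\<close>. Then the compositions with \<open>k\<close> congruent and \<open>i\<close> incongruent pairs of
  opposite parts have generating function \<open>(i + k choose k) * A^k * B^i / (1 - x)\<close>: the binomial
  coefficient chooses which of the \<open>i + k\<close> layers are the congruent ones (\<open>has_gf_comps\<close>).

  A congruent pair is a smaller part and a signed multiple of \<open>m\<close> as the difference, so
  \<open>A = x^2 (1 + x^m) / ((1 - x^2) (1 - x^m))\<close>. All pairs together give \<open>x^2 / (1 - x)^2\<close>, and
  subtracting \<open>A\<close> leaves \<open>B = 2 x^3 (1 - x^(m - 1)) / ((1 - x) (1 - x^2) (1 - x^m))\<close>
  (\<open>has_gf_cong_pairs\<close>, \<open>has_gf_noncong_pairs\<close>). Hence the generating function for given \<open>k\<close> and \<open>i\<close> is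
  \<open>2^i (i + k choose k) x^(2k + 3i)\<close> times
  \<open>(1 - x)^-(i + 1) * (1 - x^(m - 1))^i * (1 - x^2)^-(i + k) * (1 + x^m)^k * (1 - x^m)^-(i + k)\<close>.
  Expanding the five factors by the binomial theorem, with summation indices \<open>j\<close>, \<open>r\<close>, \<open>s\<close>, \<open>c\<close>, \<open>d\<close>
  in this order, and summing over \<open>i\<close> gives the formula.

  Both sides are handled by the same device: the compositions and the index tuples of the sum are
  two weighted classes, and the theorem says that they have the same generating function.
\<close>

unbundle fps_syntax

section \<open>Generating functions of weighted classes\<close>

text \<open>The series \<open>f\<close> is the sum of \<open>c x * X ^ w x\<close> over \<open>x\<close> in \<open>S\<close>. As a relation that includes the
  finiteness of the weight fibres, this applies to counting problems (\<open>c = 1\<close>) and to formal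
  expansions (\<open>c\<close> arbitrary) alike, and no finiteness conditions have to be carried beside
  the equations.\<close>

definition has_gf :: "'a set \<Rightarrow> ('a \<Rightarrow> 'r::comm_ring_1) \<Rightarrow> ('a \<Rightarrow> nat) \<Rightarrow> 'r fps \<Rightarrow> bool" where
  "has_gf S c w f \<longleftrightarrow>
     (\<forall>n. finite {x \<in> S. w x = n} \<and> f $ n = (\<Sum>x | x \<in> S \<and> w x = n. c x))"

lemma has_gfI:
  assumes "\<And>n. finite {x \<in> S. w x = n}"
    and "\<And>n. f $ n = (\<Sum>x | x \<in> S \<and> w x = n. c x)"
  shows "has_gf S c w f"
  using assms by (simp add: has_gf_def)

lemma has_gf_finite: "has_gf S c w f \<Longrightarrow> finite {x \<in> S. w x = n}"
  by (simp add: has_gf_def)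

lemma has_gf_nth: "has_gf S c w f \<Longrightarrow> f $ n = (\<Sum>x | x \<in> S \<and> w x = n. c x)"
  by (simp add: has_gf_def)

lemma has_gf_cong:
  assumes "has_gf S c w f" "S = S'" "\<And>x. x \<in> S' \<Longrightarrow> c x = c' x"
    "\<And>x. x \<in> S' \<Longrightarrow> w x = w' x" "f = f'"
  shows "has_gf S' c' w' f'"
proof (rule has_gfI)
  fix n
  have eq: "{x \<in> S'. w' x = n} = {x \<in> S. w x = n}" using assms by auto
  show "finite {x \<in> S'. w' x = n}" unfolding eq by (rule has_gf_finite[OF assms(1)])
  show "f' $ n = (\<Sum>x | x \<in> S' \<and> w' x = n. c' x)"
    unfolding eq \<open>f = f'\<close>[symmetric] has_gf_nth[OF assms(1)] using assms by (intro sum.cong) auto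
qed

lemma has_gf_bij:
  assumes gf: "has_gf S c w f" and h: "bij_betw h S S'"
    and "\<And>x. x \<in> S \<Longrightarrow> c' (h x) = c x" "\<And>x. x \<in> S \<Longrightarrow> w' (h x) = w x"
  shows "has_gf S' c' w' f"
proof (rule has_gfI)
  fix n
  have bij: "bij_betw h {x \<in> S. w x = n} {y \<in> S'. w' y = n}"
    by (rule bij_betw_subset[OF h]) (use h assms(4) in \<open>auto simp: bij_betw_def\<close>)
  show "finite {y \<in> S'. w' y = n}"
    using bij_betw_finite[OF bij] has_gf_finite[OF gf] by simp
  show "f $ n = (\<Sum>y | y \<in> S' \<and> w' y = n. c' y)"
    unfolding has_gf_nth[OF gf] sum.reindex_bij_betw[OF bij, symmetric]
    using assms(3) by (intro sum.cong) auto
qed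

lemma has_gf_Un:
  assumes "has_gf S c w f" "has_gf T c w g" "S \<inter> T = {}"
  shows "has_gf (S \<union> T) c w (f + g)"
proof (rule has_gfI)
  fix n
  have eq: "{x \<in> S \<union> T. w x = n} = {x \<in> S. w x = n} \<union> {x \<in> T. w x = n}" by auto
  have fin: "finite {x \<in> S. w x = n}" "finite {x \<in> T. w x = n}"
    using assms has_gf_finite by blast+
  show "finite {x \<in> S \<union> T. w x = n}" unfolding eq using fin by simp
  show "(f + g) $ n = (\<Sum>x | x \<in> S \<union> T \<and> w x = n. c x)"
    unfolding eq using assms(3)
    by (subst sum.union_disjoint) (auto simp: fin has_gf_nth[OF assms(1)] has_gf_nth[OF assms(2)])
qed

lemma has_gf_Diff:
  assumes "has_gf S c w f" "has_gf T c w g" "T \<subseteq> S"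
  shows "has_gf (S - T) c w (f - g)"
proof (rule has_gfI)
  fix n
  have eq: "{x \<in> S - T. w x = n} = {x \<in> S. w x = n} - {x \<in> T. w x = n}" by auto
  have fin: "finite {x \<in> S. w x = n}" using assms has_gf_finite by blast
  show "finite {x \<in> S - T. w x = n}" unfolding eq using fin by simp
  show "(f - g) $ n = (\<Sum>x | x \<in> S - T \<and> w x = n. c x)"
    unfolding eq using assms(3)
    by (subst sum_diff) (auto simp: fin has_gf_nth[OF assms(1)] has_gf_nth[OF assms(2)])
qed

text \<open>An infinite sum of series: because an element of the \<open>i\<close>-th class weighs at least \<open>i\<close>, only the
  classes with \<open>i \<le> n\<close> contribute to the coefficient of \<open>X ^ n\<close>.\<close>

lemma has_gf_Sigma:
  assumes gf: "\<And>i. has_gf (S i) (c i) (w i) (f i)"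
    and le: "\<And>i x. x \<in> S i \<Longrightarrow> i \<le> w i x"
  shows "has_gf (Sigma UNIV S) (\<lambda>(i, x). c i x) (\<lambda>(i, x). w i x)
           (Abs_fps (\<lambda>n. \<Sum>i\<le>n. f i $ n))"
proof (rule has_gfI)
  fix n
  have eq: "{x \<in> Sigma UNIV S. (case x of (i, x) \<Rightarrow> w i x) = n}
      = Sigma {..n} (\<lambda>i. {x \<in> S i. w i x = n})" using le by auto
  show "finite {x \<in> Sigma UNIV S. (case x of (i, x) \<Rightarrow> w i x) = n}"
    unfolding eq using gf has_gf_finite by blast
  show "Abs_fps (\<lambda>n. \<Sum>i\<le>n. f i $ n) $ n
      = (\<Sum>x | x \<in> Sigma UNIV S \<and> (case x of (i, x) \<Rightarrow> w i x) = n. case x of (i, x) \<Rightarrow> c i x)"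
    unfolding eq using has_gf_finite[OF gf]
    by (subst sum.Sigma[symmetric]) (auto simp: has_gf_nth[OF gf])
qed

lemma has_gf_Times:
  assumes f: "has_gf S c w f" and g: "has_gf T d v g"
  shows "has_gf (S \<times> T) (\<lambda>(x, y). c x * d y) (\<lambda>(x, y). w x + v y) (f * g)"
proof (rule has_gfI)
  fix n
  let ?S = "\<lambda>i. {x \<in> S. w x = i}" and ?T = "\<lambda>i. {y \<in> T. v y = i}"
  have eq: "{x \<in> S \<times> T. (case x of (x, y) \<Rightarrow> w x + v y) = n} = (\<Union>i\<in>{0..n}. ?S i \<times> ?T (n - i))"
    by auto
  note fin = has_gf_finite[OF f] has_gf_finite[OF g]
  show "finite {x \<in> S \<times> T. (case x of (x, y) \<Rightarrow> w x + v y) = n}"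
    unfolding eq using fin by auto
  show "(f * g) $ n = (\<Sum>x | x \<in> S \<times> T \<and> (case x of (x, y) \<Rightarrow> w x + v y) = n.
      case x of (x, y) \<Rightarrow> c x * d y)"
    unfolding eq using fin
    by (subst sum.UNION_disjoint)
      (simp_all add: fps_mult_nth has_gf_nth[OF f] has_gf_nth[OF g] sum_product
        sum.cartesian_product split_beta disjoint_iff)
qed

lemma has_gf_shift:
  assumes gf: "has_gf S c w f"
  shows "has_gf S (\<lambda>x. a * c x) (\<lambda>x. p + w x) (fps_const a * fps_X ^ p * f)"
proof (rule has_gfI)
  fix n
  have eq: "{x \<in> S. p + w x = n} = (if n < p then {} else {x \<in> S. w x = n - p})" by auto
  show "finite {x \<in> S. p + w x = n}" unfolding eq using has_gf_finite[OF gf] by simp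
  show "(fps_const a * fps_X ^ p * f) $ n = (\<Sum>x | x \<in> S \<and> p + w x = n. a * c x)"
    unfolding eq by (simp add: mult.assoc fps_X_power_mult_nth has_gf_nth[OF gf] sum_distrib_left)
qed

section \<open>Geometric and binomial series\<close>

text \<open>For \<open>p > 0\<close>, \<open>geom p\<close> and \<open>geom_pow p q\<close> are \<open>1 / (1 - X ^ p)\<close> and \<open>1 / (1 - X ^ p) ^ q\<close>. Over the
  integers, which are not a field, they are given by coefficients, and division means multiplying by
  them. In \<open>geom_pow\<close> the truncated
  subtraction gives the right values at \<open>q = 0\<close>, where the series is 1: the constant coefficient is
  \<open>0 choose 0 = 1\<close>, and the \<open>t\<close>-th one is \<open>t - 1 choose t = 0\<close> for \<open>t > 0\<close>.\<close>

definition geom :: "nat \<Rightarrow> int fps" where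
  "geom p = Abs_fps (\<lambda>n. if p dvd n then 1 else 0)"

definition geom_pow :: "nat \<Rightarrow> nat \<Rightarrow> int fps" where
  "geom_pow p q = Abs_fps (\<lambda>n. if p dvd n then int ((q + n div p - 1) choose (n div p)) else 0)"

lemma geom_pow_nth_mult: "p > 0 \<Longrightarrow> geom_pow p q $ (p * t) = int ((q + t - 1) choose t)"
  by (simp add: geom_pow_def)

lemma geom_pow_nth_not_dvd: "\<not> p dvd n \<Longrightarrow> geom_pow p q $ n = 0"
  by (simp add: geom_pow_def)

text \<open>Comparing coefficients of \<open>X ^ (p * t)\<close>, this is Pascal's rule.\<close>

lemma geom_pow_Suc:
  assumes "p > 0"
  shows "(1 - fps_X ^ p) * geom_pow p (Suc q) = geom_pow p q"
proof (rule fps_ext)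
  fix n
  let ?f = "geom_pow p (Suc q)"
  have nth: "((1 - fps_X ^ p) * ?f) $ n = ?f $ n - (if n < p then 0 else ?f $ (n - p))"
    by (simp only: left_diff_distrib fps_sub_nth fps_X_power_mult_nth mult_1_left)
  show "((1 - fps_X ^ p) * ?f) $ n = geom_pow p q $ n"
  proof (cases "p dvd n")
    case True
    then obtain t where n: "n = p * t" by blast
    show ?thesis
    proof (cases t)
      case 0
      then show ?thesis unfolding nth n using geom_pow_nth_mult[OF assms, of _ 0] assms by simp
    next
      case (Suc t')
      have "n = p * t' + p" by (simp add: n Suc)
      then have "\<not> n < p" "n - p = p * t'" by simp_all
      then have "((1 - fps_X ^ p) * ?f) $ n = ?f $ (p * t) - ?f $ (p * t')"
        unfolding nth by (simp only: if_False) (simp only: n)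
      also have "\<dots> = geom_pow p q $ (p * t)"
        by (simp only: geom_pow_nth_mult[OF assms]) (simp add: Suc)
      finally show ?thesis by (simp only: n)
    qed
  next
    case False
    then have "\<not> p dvd n - p" if "\<not> n < p" using that by (simp add: dvd_minus_self)
    with False show ?thesis unfolding nth by (auto simp: geom_pow_nth_not_dvd)
  qed
qed

lemma geom_pow_0:
  assumes "p > 0"
  shows "geom_pow p 0 = 1"
proof (rule fps_ext)
  fix n
  show "geom_pow p 0 $ n = 1 $ n"
  proof (cases "p dvd n")
    case True
    then obtain t where n: "n = p * t" by blast
    show ?thesis unfolding n geom_pow_nth_mult[OF assms] using assms by (cases t) simp_all
  next
    case False
    then have "n \<noteq> 0" by (metis dvd_0_right)
    with False show ?thesis by (simp add: geom_pow_nth_not_dvd)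
  qed
qed

lemma geom_pow_1: "geom_pow p 1 = geom p"
  by (rule fps_ext) (auto simp: geom_pow_def geom_def)

lemma geom_inverse: "p > 0 \<Longrightarrow> (1 - fps_X ^ p) * geom p = 1"
  using geom_pow_Suc[of p 0] geom_pow_0[of p] geom_pow_1[of p] by simp

lemma geom_power: "p > 0 \<Longrightarrow> geom p ^ q = geom_pow p q"
proof (induction q)
  case (Suc q)
  have "geom p ^ Suc q = geom p * ((1 - fps_X ^ p) * geom_pow p (Suc q))"
    using Suc geom_pow_Suc by simp
  also have "\<dots> = ((1 - fps_X ^ p) * geom p) * geom_pow p (Suc q)" by (simp add: mult_ac)
  finally show ?case using geom_inverse Suc.prems by simp
qed (simp add: geom_pow_0)

lemma has_gf_geom_power:
  assumes "p > 0"
  shows "has_gf UNIV (\<lambda>s. int ((q + s - 1) choose s)) (\<lambda>s. p * s) (geom p ^ q)"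
proof (rule has_gfI)
  fix n
  have eq: "{s \<in> UNIV. p * s = n} = (if p dvd n then {n div p} else {})" using assms by auto
  show "finite {s \<in> UNIV. p * s = n}" unfolding eq by simp
  show "geom p ^ q $ n = (\<Sum>s | s \<in> UNIV \<and> p * s = n. int ((q + s - 1) choose s))"
    unfolding eq by (simp add: geom_power[OF assms] geom_pow_def)
qed

lemma has_gf_geom:
  assumes "p > 0"
  shows "has_gf UNIV (\<lambda>_. 1) (\<lambda>s. p * s) (geom p)"
  using has_gf_geom_power[OF assms, of 1] by simp

text \<open>The class on the left is indexed by the exponent \<open>r\<close> of the binomial theorem and not by the monomials
  that occur. So \<open>p = 0\<close> is covered, where all terms have weight 0; this happens for the factor
  \<open>(1 - X ^ (m - 1)) ^ i\<close> when \<open>m = 1\<close>.\<close>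

lemma has_gf_binomial:
  "has_gf {..i} (\<lambda>r. a ^ r * int (i choose r)) (\<lambda>r. r * p) ((1 + fps_const a * fps_X ^ p) ^ i)"
proof (rule has_gfI)
  fix n
  show "finite {r \<in> {..i}. r * p = n}" by simp
  have "((1 + fps_const a * fps_X ^ p) ^ i) $ n
      = ((fps_const a * fps_X ^ p + 1) ^ i) $ n" by (simp add: add.commute)
  also have "\<dots> = (\<Sum>r\<le>i. (of_nat (i choose r) * (fps_const a * fps_X ^ p) ^ r) $ n)"
    by (simp add: binomial_ring fps_sum_nth)
  also have "\<dots> = (\<Sum>r\<le>i. if r * p = n then a ^ r * int (i choose r) else 0)"
  proof (rule sum.cong)
    fix r
    have "of_nat (i choose r) * (fps_const a * fps_X ^ p) ^ r
        = fps_const (a ^ r * int (i choose r)) * fps_X ^ (r * p)"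
      by (simp add: power_mult_distrib fps_const_power power_mult[symmetric] fps_of_nat[symmetric]
        mult_ac flip: fps_const_mult)
    then show "(of_nat (i choose r) * (fps_const a * fps_X ^ p) ^ r) $ n
        = (if r * p = n then a ^ r * int (i choose r) else 0)"
      by (simp add: fps_X_power_nth)
  qed simp
  also have "\<dots> = (\<Sum>r | r \<in> {..i} \<and> r * p = n. a ^ r * int (i choose r))"
    by (subst sum.inter_filter[symmetric]) simp_all
  finally show "((1 + fps_const a * fps_X ^ p) ^ i) $ n
      = (\<Sum>r | r \<in> {..i} \<and> r * p = n. a ^ r * int (i choose r))" .
qed

section \<open>Pairs of positive integers\<close>

definition pos_pairs :: "(nat \<times> nat) set" where
  "pos_pairs = {(a, b). 0 < a \<and> 0 < b}"

definition cong_pairs :: "nat \<Rightarrow> (nat \<times> nat) set" where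
  "cong_pairs m = {(a, b) \<in> pos_pairs. [a = b] (mod m)}"

lemma has_gf_pos_pairs:
  "has_gf pos_pairs (\<lambda>_. 1) (\<lambda>(a, b). a + b) (fps_X ^ 2 * geom 1 ^ 2)"
proof -
  have gf: "has_gf (UNIV \<times> UNIV) (\<lambda>(x, y). 1 * 1) (\<lambda>(x, y). 1 * x + 1 * y) (geom 1 * geom 1)"
    by (rule has_gf_Times; rule has_gf_geom) simp_all
  have "bij_betw (\<lambda>(x, y). (Suc x, Suc y)) (UNIV \<times> UNIV) pos_pairs"
    by (rule bij_betwI[where g = "\<lambda>(x, y). (x - 1, y - 1)"]) (auto simp: pos_pairs_def)
  then have "has_gf pos_pairs (\<lambda>_. 1) (\<lambda>(a, b). a + b)
      (fps_const 1 * fps_X ^ 2 * (geom 1 * geom 1))"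
    by (rule has_gf_bij[OF has_gf_shift[OF gf]]) auto
  then show ?thesis by (simp add: power2_eq_square)
qed

text \<open>The parameters of a congruent pair: \<open>s + 1\<close> is the smaller part, and the difference of the parts is
  \<open>d\<close> or \<open>-(d + 1)\<close> times \<open>m\<close>. The shift by 1 in the negative case (\<open>e = 1\<close>) keeps pairs of equal parts
  from being counted twice, and it makes the sum of the two parts equal to \<open>2 + 2 s + (e + d) m\<close>, to
  which each parameter contributes separately.\<close>

lemma bij_betw_cong_pairs:
  assumes "m > 0"
  shows "bij_betw (\<lambda>(s, e, d). if e = 0 then (s + 1 + m * d, s + 1) else (s + 1, s + 1 + m * (d + 1)))
    (UNIV \<times> {..1::nat} \<times> UNIV) (cong_pairs m)"
proof (rule bij_betwI[where g = "\<lambda>(a, b). if a \<ge> b then (b - 1, 0, (a - b) div m)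
    else (a - 1, 1, (b - a) div m - 1)"])
  let ?h = "\<lambda>(s, e, d). if e = 0 then (s + 1 + m * d, s + 1) else (s + 1, s + 1 + m * (d + 1))"
  let ?g = "\<lambda>(a, b). if a \<ge> b then (b - 1, 0::nat, (a - b) div m)
    else (a - 1, 1, (b - a) div m - 1)"
  have "Suc (a + (m + m * d)) mod m = Suc a mod m" for a d
    using mod_mult_self2[of "Suc a" m "Suc d"] by simp
  then show "?h \<in> UNIV \<times> {..1} \<times> UNIV \<rightarrow> cong_pairs m"
    by (auto simp: cong_pairs_def pos_pairs_def cong_def split: if_splits)
  show "?g \<in> cong_pairs m \<rightarrow> UNIV \<times> {..1} \<times> UNIV" by auto
  show "?g (?h x) = x" if "x \<in> UNIV \<times> {..1} \<times> UNIV" for x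
    using that assms by (auto simp: le_Suc_eq simp flip: One_nat_def)
  show "?h (?g y) = y" if y: "y \<in> cong_pairs m" for y
  proof -
    obtain a b where ab: "y = (a, b)" "a > 0" "b > 0" "[a = b] (mod m)"
      using y by (auto simp: cong_pairs_def pos_pairs_def)
    show ?thesis
    proof (cases "a \<ge> b")
      case True
      then have "m * ((a - b) div m) = a - b" using ab(4) cong_altdef_nat[of b a m] by simp
      then show ?thesis using True ab by simp
    next
      case False
      then have "m dvd b - a" using ab(4) cong_altdef_nat[of a b m] cong_sym by auto
      then obtain t where t: "b - a = m * t" by blast
      then have "t > 0" using False by (cases t) auto
      then have "m * (t - 1 + 1) = b - a" using t by simp
      then show ?thesis using False ab t assms by auto
    qed
  qed
qed

lemma has_gf_cong_pairs:
  assumes "m > 0"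
  shows "has_gf (cong_pairs m) (\<lambda>_. 1) (\<lambda>(a, b). a + b)
    (fps_X ^ 2 * (geom 2 * ((1 + fps_X ^ m) * geom m)))"
proof -
  \<comment> \<open>the sign of the difference, as the binomial expansion of \<open>(1 + X ^ m) ^ 1\<close>\<close>
  have two: "has_gf {..1::nat} (\<lambda>_. 1::int) (\<lambda>e. e * m) (1 + fps_X ^ m)"
    by (rule has_gf_cong[OF has_gf_binomial[of 1 1 m]]) (auto simp: le_Suc_eq)
  have gf: "has_gf (UNIV \<times> {..1} \<times> UNIV) (\<lambda>(s, y). 1 * (case y of (e, d) \<Rightarrow> 1 * 1))
      (\<lambda>(s, y). 2 * s + (case y of (e, d) \<Rightarrow> e * m + m * d)) (geom 2 * ((1 + fps_X ^ m) * geom m))"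
    by (intro has_gf_Times has_gf_geom two assms) simp
  have "has_gf (cong_pairs m) (\<lambda>_. 1) (\<lambda>(a, b). a + b)
      (fps_const 1 * fps_X ^ 2 * (geom 2 * ((1 + fps_X ^ m) * geom m)))"
    by (rule has_gf_bij[OF has_gf_shift[OF gf] bij_betw_cong_pairs[OF assms]])
      (auto simp: le_Suc_eq algebra_simps)
  then show ?thesis by simp
qed

text \<open>Over the common denominator \<open>(1 - X) (1 - X^2) (1 - X^m)\<close>, subtracting the congruent pairs from all
  pairs leaves the numerator \<open>X^2 ((1 + X) (1 - X^m) - (1 - X) (1 + X^m)) = 2 X^2 (X - X^m)\<close>.\<close>

lemma has_gf_noncong_pairs:
  assumes "m > 0"
  shows "has_gf (pos_pairs - cong_pairs m) (\<lambda>_. 1) (\<lambda>(a, b). a + b)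
    (2 * fps_X ^ 3 * (1 - fps_X ^ (m - 1)) * geom 1 * geom 2 * geom m)"
proof (rule has_gf_cong[OF has_gf_Diff[OF has_gf_pos_pairs has_gf_cong_pairs[OF assms]]])
  let ?X = "fps_X :: int fps"
  have X: "?X ^ m = ?X * ?X ^ (m - 1)" using assms by (simp flip: power_Suc)
  have 1: "(1 - ?X) * geom 1 = 1" and 2: "(1 - ?X ^ 2) * geom 2 = 1"
    and m: "(1 - ?X ^ m) * geom m = 1"
    using geom_inverse[of 1] geom_inverse[of 2] geom_inverse[OF assms] by simp_all
  have "geom 1 * ((1 - ?X ^ 2) * geom 2) = ((1 - ?X) * geom 1) * ((1 + ?X) * geom 2)"
    by (simp add: algebra_simps power2_eq_square)
  then have 12: "geom 1 = (1 + ?X) * geom 2" unfolding 1 2 by simp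
  \<comment> \<open>bring both series to the common denominator, inserting factors that are equal to 1\<close>
  have "?X ^ 2 * geom 1 ^ 2 = ?X ^ 2 * geom 1 * ((1 + ?X) * geom 2) * ((1 - ?X ^ m) * geom m)"
    using 12 m by (simp add: power2_eq_square mult.assoc)
  moreover have "?X ^ 2 * (geom 2 * ((1 + ?X ^ m) * geom m))
      = ?X ^ 2 * (geom 2 * ((1 + ?X ^ m) * geom m)) * ((1 - ?X) * geom 1)"
    using 1 by simp
  ultimately show "?X ^ 2 * geom 1 ^ 2 - ?X ^ 2 * (geom 2 * ((1 + ?X ^ m) * geom m))
      = 2 * ?X ^ 3 * (1 - ?X ^ (m - 1)) * geom 1 * geom 2 * geom m"
    by (simp only: X) (simp add: algebra_simps power2_eq_square power3_eq_cube)
qed (auto simp: cong_pairs_def)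

section \<open>Compositions by their numbers of congruent and incongruent pairs\<close>

text \<open>The condition on a pair is a parameter, so that congruent and incongruent pairs are counted by the
  same function and obey the same recursion when a list is wrapped.\<close>

definition opposite_pairs :: "(nat \<Rightarrow> nat \<Rightarrow> bool) \<Rightarrow> nat list \<Rightarrow> nat" where
  "opposite_pairs Q \<alpha> = card {i \<in> {1..length \<alpha> div 2}. Q (\<alpha> ! (i - 1)) (\<alpha> ! (length \<alpha> - i))}"

lemma opposite_pairs_short: "length \<alpha> \<le> 1 \<Longrightarrow> opposite_pairs Q \<alpha> = 0"
  by (simp add: opposite_pairs_def)

text \<open>The new outer pair has index 1, and wrapping moves every old pair to the next index.\<close>

lemma opposite_pairs_wrap:
  "opposite_pairs Q (a # \<beta> @ [b]) = (if Q a b then 1 else 0) + opposite_pairs Q \<beta>"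
proof -
  let ?l = "length \<beta>" and ?\<alpha> = "a # \<beta> @ [b]"
  let ?J = "{1..?l div 2}"
  let ?I = "{i \<in> ?J. Q (\<beta> ! (i - 1)) (\<beta> ! (?l - i))}"
  define R where "R i \<longleftrightarrow> Q (?\<alpha> ! (i - 1)) (?\<alpha> ! (length ?\<alpha> - i))" for i
  have outer: "R 1 \<longleftrightarrow> Q a b" by (simp add: R_def nth_append)
  have inner: "R (Suc i) \<longleftrightarrow> Q (\<beta> ! (i - 1)) (\<beta> ! (?l - i))" if "i \<in> ?J" for i
  proof -
    have "i \<ge> 1" "i \<le> ?l" using that by auto
    then have "length ?\<alpha> - Suc i = Suc (?l - i)" "?l - i < ?l" "i - 1 < ?l" by auto
    then show ?thesis using \<open>i \<ge> 1\<close> unfolding R_def by (simp add: nth_append nth_Cons')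
  qed
  have "{1..Suc n} = insert 1 (Suc ` {1..n})" for n
    by (simp add: image_Suc_atLeastAtMost atLeastAtMost_insertL del: One_nat_def) auto
  then have split: "{1..length ?\<alpha> div 2} = insert 1 (Suc ` ?J)" by simp
  have "{i \<in> insert 1 (Suc ` ?J). R i} = {i \<in> {1}. R i} \<union> Suc ` {i \<in> ?J. R (Suc i)}"
    by blast
  also have "{i \<in> ?J. R (Suc i)} = ?I" using inner by blast
  finally have "opposite_pairs Q ?\<alpha> = card ({i \<in> {1}. R i} \<union> Suc ` ?I)"
    unfolding opposite_pairs_def split R_def by (rule arg_cong)
  also have "\<dots> = card {i \<in> {1}. R i} + card (Suc ` ?I)"
    by (rule card_Un_disjoint) auto
  also have "{i \<in> {1}. R i} = (if Q a b then {1} else {})" using outer by auto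
  finally show ?thesis by (simp add: card_image opposite_pairs_def)
qed

definition comps :: "nat \<Rightarrow> nat \<Rightarrow> nat \<Rightarrow> nat list set" where
  "comps m k i = {\<alpha>. (\<forall>a \<in> set \<alpha>. 0 < a) \<and> opposite_pairs (\<lambda>a b. [a = b] (mod m)) \<alpha> = k
     \<and> opposite_pairs (\<lambda>a b. \<not> [a = b] (mod m)) \<alpha> = i}"

definition wrap :: "(nat \<times> nat) set \<Rightarrow> nat list set \<Rightarrow> nat list set" where
  "wrap P S = (\<lambda>((a, b), \<beta>). a # \<beta> @ [b]) ` (P \<times> S)"

text \<open>A wrapped list determines its outer pair and its interior, so wrapping multiplies generating
  functions.\<close>

lemma has_gf_wrap:
  assumes "has_gf P (\<lambda>_. 1) (\<lambda>(a, b). a + b) f" "has_gf S (\<lambda>_. 1) sum_list g"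
  shows "has_gf (wrap P S) (\<lambda>_. 1) sum_list (f * g)"
proof (rule has_gf_bij[OF has_gf_Times[OF assms]])
  show "bij_betw (\<lambda>((a, b), \<beta>). a # \<beta> @ [b]) (P \<times> S) (wrap P S)"
    unfolding wrap_def by (rule inj_on_imp_bij_betw) (auto simp: inj_on_def)
qed auto

lemma list_outer_cases:
  obtains "length \<alpha> \<le> 1" | a \<beta> b where "\<alpha> = a # \<beta> @ [b]"
proof (cases \<alpha>)
  case (Cons a \<gamma>)
  then show ?thesis
  proof (cases \<gamma> rule: rev_cases)
    case Nil
    then show ?thesis using Cons by (intro that(1)) simp
  next
    case (snoc \<beta> b)
    then show ?thesis using Cons by (intro that(2)) simp
  qed
qed (simp add: that(1))

lemma comps_0_0: "comps m 0 0 = {\<alpha>. (\<forall>a \<in> set \<alpha>. 0 < a) \<and> length \<alpha> \<le> 1}"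
proof -
  have "length \<alpha> \<le> 1" if \<alpha>: "\<alpha> \<in> comps m 0 0" for \<alpha>
  proof (cases \<alpha> rule: list_outer_cases)
    case (2 a \<beta> b)
    show ?thesis using \<alpha> unfolding comps_def \<open>\<alpha> = _\<close>
      by (cases "[a = b] (mod m)") (simp_all add: opposite_pairs_wrap)
  qed
  moreover have "\<alpha> \<in> comps m 0 0 \<longleftrightarrow> (\<forall>a \<in> set \<alpha>. 0 < a)" if "length \<alpha> \<le> 1" for \<alpha>
    using opposite_pairs_short[OF that] by (simp add: comps_def)
  ultimately show ?thesis by blast
qed

lemma wrap_iff: "a # \<beta> @ [b] \<in> wrap P S \<longleftrightarrow> (a, b) \<in> P \<and> \<beta> \<in> S"
  by (force simp: wrap_def image_iff)

lemma short_notin_wrap: "length \<alpha> \<le> 1 \<Longrightarrow> \<alpha> \<notin> wrap P S"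
  by (auto simp: wrap_def)

text \<open>A composition with some pair of opposite parts arises in exactly one way by wrapping its outermost
  pair, which is either congruent or incongruent.\<close>

lemma comps_rec:
  assumes "k > 0 \<or> i > 0"
  shows "comps m k i = (if k = 0 then {} else wrap (cong_pairs m) (comps m (k - 1) i))
    \<union> (if i = 0 then {} else wrap (pos_pairs - cong_pairs m) (comps m k (i - 1)))"
    (is "_ = ?R")
proof (rule set_eqI)
  fix \<alpha>
  show "\<alpha> \<in> comps m k i \<longleftrightarrow> \<alpha> \<in> ?R"
  proof (cases \<alpha> rule: list_outer_cases)
    case 1
    then show ?thesis using assms
      by (auto simp: comps_def opposite_pairs_short short_notin_wrap)
  next
    case (2 a \<beta> b)
    have "\<alpha> \<in> comps m k i \<longleftrightarrow> (a, b) \<in> pos_pairs \<and>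
        (if [a = b] (mod m) then k \<noteq> 0 \<and> \<beta> \<in> comps m (k - 1) i
         else i \<noteq> 0 \<and> \<beta> \<in> comps m k (i - 1))"
      unfolding comps_def \<open>\<alpha> = _\<close> mem_Collect_eq opposite_pairs_wrap
      by (cases k; cases i) (auto simp: pos_pairs_def)
    also have "\<dots> \<longleftrightarrow> \<alpha> \<in> ?R"
      by (simp add: \<open>\<alpha> = _\<close> wrap_iff cong_pairs_def)
    finally show ?thesis .
  qed
qed

lemma has_gf_comps_0_0: "has_gf (comps m 0 0) (\<lambda>_. 1) sum_list (geom 1)"
proof (rule has_gf_bij[OF has_gf_geom])
  show "bij_betw (\<lambda>n. if n = 0 then [] else [n]) UNIV (comps m 0 0)"
    unfolding comps_0_0
    by (rule bij_betwI[where g = sum_list]) (auto simp: le_Suc_eq length_Suc_conv)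
qed auto

text \<open>By induction on the number of pairs; the recursion for the outermost pair turns into Pascal's rule
  for the coefficient \<open>i + k choose k\<close>.\<close>

lemma has_gf_comps:
  assumes A: "has_gf (cong_pairs m) (\<lambda>_. 1) (\<lambda>(a, b). a + b) A"
    and B: "has_gf (pos_pairs - cong_pairs m) (\<lambda>_. 1) (\<lambda>(a, b). a + b) B"
  shows "has_gf (comps m k i) (\<lambda>_. 1) sum_list (of_nat ((i + k) choose k) * A ^ k * B ^ i * geom 1)"
proof (induction "k + i" arbitrary: k i)
  case 0
  then show ?case using has_gf_comps_0_0 by simp
next
  case (Suc N)
  let ?G = "\<lambda>k i. of_nat ((i + k) choose k) * A ^ k * B ^ i * geom 1"
  have empty: "has_gf {} (\<lambda>_. 1) sum_list 0" by (rule has_gfI) auto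
  have 1: "has_gf (if k = 0 then {} else wrap (cong_pairs m) (comps m (k - 1) i)) (\<lambda>_. 1) sum_list
      (if k = 0 then 0 else A * ?G (k - 1) i)"
  proof (cases "k = 0")
    case False
    then have "N = (k - 1) + i" using Suc.hyps(2) by simp
    then have "has_gf (wrap (cong_pairs m) (comps m (k - 1) i)) (\<lambda>_. 1) sum_list (A * ?G (k - 1) i)"
      by (rule has_gf_wrap[OF A Suc.hyps(1)])
    then show ?thesis by (simp only: False if_False)
  qed (simp add: empty)
  have 2: "has_gf (if i = 0 then {} else wrap (pos_pairs - cong_pairs m) (comps m k (i - 1)))
      (\<lambda>_. 1) sum_list (if i = 0 then 0 else B * ?G k (i - 1))"
  proof (cases "i = 0")
    case False
    then have "N = k + (i - 1)" using Suc.hyps(2) by simp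
    then have "has_gf (wrap (pos_pairs - cong_pairs m) (comps m k (i - 1))) (\<lambda>_. 1) sum_list
        (B * ?G k (i - 1))"
      by (rule has_gf_wrap[OF B Suc.hyps(1)])
    then show ?thesis by (simp only: False if_False)
  qed (simp add: empty)
  have "has_gf (comps m k i) (\<lambda>_. 1) sum_list
      ((if k = 0 then 0 else A * ?G (k - 1) i) + (if i = 0 then 0 else B * ?G k (i - 1)))"
    using has_gf_Un[OF 1 2] Suc.hyps(2) comps_rec[of k i m] by (force simp: wrap_def)
  moreover have "(if k = 0 then 0 else A * ?G (k - 1) i) + (if i = 0 then 0 else B * ?G k (i - 1))
      = ?G k i"
    using Suc.hyps(2) by (cases k; cases i) (simp_all add: algebra_simps)
  ultimately show ?case by simp
qed

text \<open>This bound allows the sum over the number \<open>i\<close> of incongruent pairs.\<close>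

lemma index_le_sum_list:
  assumes "\<alpha> \<in> comps m k i"
  shows "i \<le> sum_list \<alpha>"
proof -
  have "i = opposite_pairs (\<lambda>a b. \<not> [a = b] (mod m)) \<alpha>"
    using assms by (simp add: comps_def)
  have "i \<le> card {1..length \<alpha> div 2}"
    unfolding \<open>i = _\<close> opposite_pairs_def by (rule card_mono) auto
  also have "\<dots> \<le> length \<alpha>" by simp
  also have "length \<alpha> \<le> sum_list \<alpha>" if "\<forall>a \<in> set \<alpha>. 0 < a" for \<alpha> :: "nat list"
    using that by (induction \<alpha>) auto
  then have "length \<alpha> \<le> sum_list \<alpha>" using assms by (simp add: comps_def)
  finally show ?thesis .
qed

section \<open>Expansion of the generating function\<close>

lemma gf_comps_factorization:
  fixes m k i :: nat
  defines "A \<equiv> fps_X ^ 2 * (geom 2 * ((1 + fps_X ^ m) * geom m))"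
    and "B \<equiv> 2 * fps_X ^ 3 * (1 - fps_X ^ (m - 1)) * geom 1 * geom 2 * geom m"
  shows "of_nat ((i + k) choose k) * A ^ k * B ^ i * geom 1
    = fps_const (2 ^ i * int ((i + k) choose k)) * fps_X ^ (2 * k + 3 * i)
      * (geom 1 ^ (i + 1) * ((1 - fps_X ^ (m - 1)) ^ i * (geom 2 ^ (i + k)
      * ((1 + fps_X ^ m) ^ k * geom m ^ (i + k)))))"
proof -
  have c: "fps_const (2 ^ i * int ((i + k) choose k)) = 2 ^ i * of_nat ((i + k) choose k)"
    by (simp add: fps_of_nat numeral_fps_const flip: fps_const_mult fps_const_power)
  show ?thesis unfolding A_def B_def c
    by (simp add: power_mult_distrib power_add power_mult[symmetric] mult_ac)
qed

text \<open>The tuples \<open>(j, r, s, c, d)\<close> for fixed \<open>i\<close>. The finite binomial expansions have bounded exponents \<open>r\<close> and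
  \<open>c\<close>; outside these bounds the term of the formula vanishes.\<close>

definition expansion_indices ::
  "nat \<Rightarrow> nat \<Rightarrow> (nat \<times> nat \<times> nat \<times> nat \<times> nat) set" where
  "expansion_indices k i = UNIV \<times> {..i} \<times> UNIV \<times> {..k} \<times> UNIV"

text \<open>The linear form of the index condition with \<open>2 k\<close> moved to the left, which makes it an equation in
  natural numbers. So the case \<open>n < 2 * k\<close>, where there are no indices at all, is an ordinary
  instance.\<close>

definition expansion_weight :: "nat \<Rightarrow> nat \<Rightarrow> nat \<times> nat \<times> nat \<times> nat \<times> nat \<times> nat \<Rightarrow> nat" where
  "expansion_weight m k = (\<lambda>(i, j, r, s, c, d).
     2 * k + 3 * i + j + r * (m - 1) + 2 * s + c * m + d * m)"

lemma binom_of_nat: "binom (int a) (int b) = int (a choose b)"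
  by (auto simp: binom_def binomial_eq_0)

text \<open>At \<open>a = s = 0\<close> the upper argument on the left is \<open>-1\<close>, where the convention for \<open>binom\<close> gives the value 1
  of the truncated right side.\<close>

lemma binom_multiset: "binom (int a + int s - 1) (int s) = int ((a + s - 1) choose s)"
proof (cases "a + s = 0")
  case False
  then have "int a + int s - 1 = int (a + s - 1)" by auto
  then show ?thesis by (simp only: binom_of_nat)
qed (simp add: binom_def)

lemma has_gf_expansion:
  assumes "m > 0"
  shows "has_gf (expansion_indices k i) (\<lambda>x. ac_term k (i, x)) (\<lambda>x. expansion_weight m k (i, x))
    (fps_const (2 ^ i * int ((i + k) choose k)) * fps_X ^ (2 * k + 3 * i)
      * (geom 1 ^ (i + 1) * ((1 - fps_X ^ (m - 1)) ^ i * (geom 2 ^ (i + k)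
      * ((1 + fps_X ^ m) ^ k * geom m ^ (i + k))))))"
proof -
  have 1: "has_gf UNIV (\<lambda>j. int ((i + 1 + j - 1) choose j)) (\<lambda>j. 1 * j) (geom 1 ^ (i + 1))"
    by (rule has_gf_geom_power) simp
  have 2: "has_gf {..i} (\<lambda>r. (- 1) ^ r * int (i choose r)) (\<lambda>r. r * (m - 1))
      ((1 - fps_X ^ (m - 1)) ^ i)"
    using has_gf_binomial[of i "-1" "m - 1"] by (simp flip: fps_const_neg)
  have 3: "has_gf UNIV (\<lambda>s. int ((i + k + s - 1) choose s)) (\<lambda>s. 2 * s) (geom 2 ^ (i + k))"
    by (rule has_gf_geom_power) simp
  have 4: "has_gf {..k} (\<lambda>c. int (k choose c)) (\<lambda>c. c * m) ((1 + fps_X ^ m) ^ k)"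
    using has_gf_binomial[of k 1 m] by simp
  have 5: "has_gf UNIV (\<lambda>d. int ((i + k + d - 1) choose d)) (\<lambda>d. m * d) (geom m ^ (i + k))"
    by (rule has_gf_geom_power) fact
  note gf = has_gf_Times[OF 1 has_gf_Times[OF 2 has_gf_Times[OF 3 has_gf_Times[OF 4 5]]]]
  have binoms: "binom (int i + int k) (int k) = int ((i + k) choose k)"
    "binom (int i + int j) (int j) = int ((i + j) choose j)"
    "binom (int i + int k + int s - 1) (int s) = int ((i + k + s - 1) choose s)" for j s
    using binom_of_nat[of "i + k" k] binom_of_nat[of "i + j" j] binom_multiset[of "i + k" s]
    by simp_all
  show ?thesis
    by (rule has_gf_cong[OF has_gf_shift[OF gf]])
      (auto simp: expansion_indices_def expansion_weight_def ac_term_def binoms binom_of_nat)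
qed

lemma expansion_weight_eq_iff:
  assumes "m > 0"
  shows "expansion_weight m k x = n \<longleftrightarrow> x \<in> ac_index m n k"
proof -
  obtain i j r s c d where x: "x = (i, j, r, s, c, d)" by (cases x) auto
  have "int (m - 1) = int m - 1" using assms by auto
  then have "int (expansion_weight m k x) = 2 * int k + (3 * int i + int j + int r * (int m - 1)
      + 2 * int s + int c * int m + int d * int m)"
    by (simp add: x expansion_weight_def)
  moreover have "expansion_weight m k x = n \<longleftrightarrow> int (expansion_weight m k x) = int n" by simp
  ultimately show ?thesis by (auto simp: x ac_index_def)
qed

lemma ac_term_eq_0: "x \<notin> Sigma UNIV (expansion_indices k) \<Longrightarrow> ac_term k x = 0"
  by (cases x) (auto simp: expansion_indices_def ac_term_def binom_of_nat)

theorem theorem6p2: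
  fixes m n k :: nat
  assumes "m > 0"
  shows "int (ac k n m) = Sum_any (\<lambda>x. if x \<in> ac_index m n k then ac_term k x else 0)"
proof -
  define f where "f i = of_nat ((i + k) choose k)
    * (fps_X ^ 2 * (geom 2 * ((1 + fps_X ^ m) * geom m))) ^ k
    * (2 * fps_X ^ 3 * (1 - fps_X ^ (m - 1)) * geom 1 * geom 2 * geom m) ^ i * geom 1" for i
  let ?F = "Abs_fps (\<lambda>n. \<Sum>i\<le>n. f i $ n)"
  \<comment> \<open>two classes with the same generating function, for each number \<open>i\<close> of incongruent pairs\<close>
  have comps: "has_gf (comps m k i) (\<lambda>_. 1) sum_list (f i)" for i
    unfolding f_def
    by (rule has_gf_comps[OF has_gf_cong_pairs[OF assms] has_gf_noncong_pairs[OF assms]])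
  have terms: "has_gf (expansion_indices k i) (\<lambda>x. ac_term k (i, x))
      (\<lambda>x. expansion_weight m k (i, x)) (f i)" for i
    unfolding f_def gf_comps_factorization by (rule has_gf_expansion[OF assms])
  let ?C = "{\<alpha>. (\<forall>a \<in> set \<alpha>. 0 < a) \<and> opposite_pairs (\<lambda>a b. [a = b] (mod m)) \<alpha> = k}"
  \<comment> \<open>forgetting \<open>i\<close> loses nothing, since the composition determines it\<close>
  have bij: "bij_betw snd (Sigma UNIV (comps m k)) ?C"
    by (rule bij_betwI[where g = "\<lambda>\<alpha>. (opposite_pairs (\<lambda>a b. \<not> [a = b] (mod m)) \<alpha>, \<alpha>)"])
      (auto simp: comps_def)
  have "has_gf (Sigma UNIV (comps m k)) (\<lambda>(i, \<alpha>). 1) (\<lambda>(i, \<alpha>). sum_list \<alpha>) ?F"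
    by (rule has_gf_Sigma[OF comps]) (rule index_le_sum_list)
  then have 1: "has_gf ?C (\<lambda>_. 1) sum_list ?F"
    by (rule has_gf_bij[OF _ bij]) auto
  let ?E = "Sigma UNIV (expansion_indices k)"
  have "has_gf ?E (\<lambda>(i, x). ac_term k (i, x)) (\<lambda>(i, x). expansion_weight m k (i, x)) ?F"
    by (rule has_gf_Sigma[OF terms]) (auto simp: expansion_weight_def)
  then have 2: "has_gf ?E (ac_term k) (expansion_weight m k) ?F" by simp
  let ?g = "\<lambda>x. if x \<in> ac_index m n k then ac_term k x else 0"
  have "int (ac k n m) = (\<Sum>\<alpha> | \<alpha> \<in> ?C \<and> sum_list \<alpha> = n. 1)"
    by (simp add: ac_def compositions_def opposite_pairs_def conj_ac)
  also have "\<dots> = (\<Sum>x | x \<in> ?E \<and> expansion_weight m k x = n. ac_term k x)"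
    using has_gf_nth[OF 1, of n] has_gf_nth[OF 2, of n] by simp
  also have "\<dots> = (\<Sum>x | x \<in> ?E \<and> expansion_weight m k x = n. ?g x)"
    by (intro sum.cong) (auto simp: expansion_weight_eq_iff[OF assms])
  also have "\<dots> = Sum_any ?g"
  proof (rule Sum_any.expand_superset[symmetric])
    show "finite {x. x \<in> ?E \<and> expansion_weight m k x = n}" by (rule has_gf_finite[OF 2])
    show "{x. ?g x \<noteq> 0} \<subseteq> {x. x \<in> ?E \<and> expansion_weight m k x = n}"
    proof
      fix x assume "x \<in> {x. ?g x \<noteq> 0}"
      then have "x \<in> ac_index m n k" "ac_term k x \<noteq> 0" by (simp_all split: if_splits)
      then show "x \<in> {x. x \<in> ?E \<and> expansion_weight m k x = n}"
        using ac_term_eq_0 expansion_weight_eq_iff[OF assms] by blast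
    qed
  qed
  finally show ?thesis .
qed

end
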